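(* Let $A,B,C,D$ be real constant matrices of compatible dimensions ($D$ arbitrary), and let $\{\hat{\boldsymbol{\Phi}}_{\mathbf{x}\mathbf{x}}, \hat{\boldsymbol{\Phi}}_{\mathbf{u}\mathbf{x}}, \hat{\boldsymbol{\Phi}}_{\mathbf{x}\mathbf{y}}, \hat{\boldsymbol{\Phi}}_{\mathbf{u}\mathbf{y}}\}$ satisfy $$\begin{bmatrix} zI-A & -B\end{bmatrix}\begin{bmatrix}\hat{\boldsymbol{\Phi}}_{\mathbf{x}\mathbf{x}} & \hat{\boldsymbol{\Phi}}_{\mathbf{x}\mathbf{y}}\\ \hat{\boldsymbol{\Phi}}_{\mathbf{u}\mathbf{x}} & \hat{\boldsymbol{\Phi}}_{\mathbf{u}\mathbf{y}}\end{bmatrix} = \begin{bmatrix} I & O\end{bmatrix},\qquad \begin{bmatrix}\hat{\boldsymbol{\Phi}}_{\mathbf{x}\mathbf{x}} & \hat{\boldsymbol{\Phi}}_{\mathbf{x}\mathbf{y}}\\ \hat{\boldsymbol{\Phi}}_{\mathbf{u}\mathbf{x}} & \hat{\boldsymbol{\Phi}}_{\mathbf{u}\mathbf{y}}\end{bmatrix}\begin{bmatrix} zI-A\\ -C\end{bmatrix}=\begin{bmatrix} I\\ O\end{bmatrix},$$ $$\hat{\boldsymbol{\Phi}}_{\mathbf{x}\mathbf{x}},\hat{\boldsymbol{\Phi}}_{\mathbf{x}\mathbf{y}},\hat{\boldsymbol{\Phi}}_{\mathbf{u}\mathbf{x}}\in z^{-1}\mathcal{RH}_\infty,\qquad \hat{\boldsymbol{\Phi}}_{\mathbf{u}\mathbf{y}}\in\mathcal{RH}_\infty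 .$$ Consider an additive perturbation $\boldsymbol{\Delta}$ on the plant such that $$A(\boldsymbol{\Delta})=A+\boldsymbol{\Delta}_A,\quad B(\boldsymbol{\Delta})=B+\boldsymbol{\Delta}_B,\quad C(\boldsymbol{\Delta})=C+\boldsymbol{\Delta}_C,\quad D(\boldsymbol{\Delta})=D+\boldsymbol{\Delta}_D,$$ where $\boldsymbol{\Delta}_A,\boldsymbol{\Delta}_B,\boldsymbol{\Delta}_C,\boldsymbol{\Delta}_D\in\mathcal{RH}_\infty$. Let $\hat{\mathbf{K}}_0=\hat{\boldsymbol{\Phi}}_{\mathbf{u}\mathbf{y}}-\hat{\boldsymbol{\Phi}}_{\mathbf{u}\mathbf{x}}\hat{\boldsymbol{\Phi}}_{\mathbf{x}\mathbf{x}}^{-1}\hat{\boldsymbol{\Phi}}_{\mathbf{x}\mathbf{y}}$ and assume that $(I+D\hat{\mathbf{K}}_0)^{-1}$ exists and is proper. Then the nominal controller $$\hat{\mathbf{K}}=\hat{\mathbf{K}}_0\,(I+D\hat{\mathbf{K}}_0)^{-1}$$ internally stabilizes the perturbed system if and only if $\boldsymbol{\Psi}\in\mathcal{RH}_\infty$, where $$\boldsymbol{\Psi}=\left(I-\begin{bmatrix}\boldsymbol{\Delta}_A & \boldsymbol{\Delta}_B\\ \boldsymbol{\Delta}_C & \boldsymbol{\Delta}_D\end{bmatrix}\begin{bmatrix}\hat{\boldsymbol{\Phi}}_{\mathbf{x}\mathbf{x}} & \hat{\boldsymbol{\Phi}}_{\mathbf{x}\mathbf{y}}\\ \hat{\boldsymbol{\Phi}}_{\mathbf{u}\mathbf{x}}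 & \hat{\boldsymbol{\Phi}}_{\mathbf{u}\mathbf{y}}\end{bmatrix}\right)^{-1}.$$
   Context: Discrete time. Transfer matrices are matrices of real rational functions of $z$; $\mathcal{RH}_\infty$ is the set of stable proper ones (all poles in the open unit disc), and $z^{-1}\mathcal{RH}_\infty=\{z^{-1}\mathbf{F}:\mathbf{F}\in\mathcal{RH}_\infty\}$. A statement that an inverse lies in $\mathcal{RH}_\infty$ includes that the inverse exists. $I$ and $O$ are identity and zero matrices. The perturbed closed-loop output-feedback system with a proper controller $\mathbf{K}$ has internal state $\boldsymbol{\eta}$ stacking state $\mathbf{x}$, control $\mathbf{u}$ and measurement $\mathbf{y}$, and obeys $\boldsymbol{\eta}=\mathbf{R}(\boldsymbol{\Delta})\boldsymbol{\eta}+\mathbf{d}$ with arbitrary external disturbance $\mathbf{d}$ and $$\mathbf{R}(\boldsymbol{\Delta})=\begin{bmatrix} A(\boldsymbol{\Delta})+(1-z)I & B(\boldsymbol{\Delta}) & O\\ O & O & \mathbf{K}\\ C(\boldsymbol{\Delta}) & D(\boldsymbol{\Delta}) & O\end{bmatrix}.$$ The controller $\mathbf{K}$ internally stabilizes the perturbed system if $\mathbf{S}(\boldsymbol{\Delta})=(I-\mathbf{R}(\boldsymbol{\Delta}))^{-1}$ exists and lies in $\mathcal{RH}_\infty$. *)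

theory Defs
  imports
    "HOL-Computational_Algebra.Field_as_Ring"
    "HOL-Computational_Algebra.Polynomial_Factorial"
    "Jordan_Normal_Form.Gauss_Jordan_Elimination"
begin

text \<open>
  Scalar transfer functions are elements of the field \<open>\<real>(z)\<close>; transfer matrices are
  matrices over this field.
\<close>

type_synonym tf = "real poly fract"

definition tf_z :: tf where
  "tf_z = to_fract [:0, 1:]"

definition const_tf_mat :: "real mat \<Rightarrow> tf mat" where
  "const_tf_mat = map_mat (\<lambda>c. to_fract [:c:])"

text \<open>
  \<open>quot_of_fract\<close> returns the representation in lowest terms, so that the poles are
  exactly the complex zeros of its second component.
\<close>

definition tf_poles :: "tf \<Rightarrow> complex set" where
  "tf_poles f = {w. poly (map_poly complex_of_real (snd (quot_of_fract f))) w = 0}"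

definition tf_proper :: "tf \<Rightarrow> bool" where
  "tf_proper f \<longleftrightarrow> degree (fst (quot_of_fract f)) \<le> degree (snd (quot_of_fract f))"

definition tf_stable :: "tf \<Rightarrow> bool" where
  "tf_stable f \<longleftrightarrow> (\<forall>w\<in>tf_poles f. norm w < 1)"

definition proper_mats :: "nat \<Rightarrow> nat \<Rightarrow> tf mat set" where
  "proper_mats r c = {F \<in> carrier_mat r c. \<forall>i<r. \<forall>j<c. tf_proper (F $$ (i, j))}"

definition RHinf :: "nat \<Rightarrow> nat \<Rightarrow> tf mat set" where
  "RHinf r c =
     {F \<in> carrier_mat r c. \<forall>i<r. \<forall>j<c. tf_proper (F $$ (i, j)) \<and> tf_stable (F $$ (i, j))}"

definition zinv_RHinf :: "nat \<Rightarrow> nat \<Rightarrow> tf mat set" where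
  "zinv_RHinf r c = {inverse tf_z \<cdot>\<^sub>m F | F. F \<in> RHinf r c}"

text \<open>
  \<open>mat_inv M\<close> is meaningful only if \<open>invertible_mat M\<close>; membership of an inverse in a
  class of transfer matrices is therefore always stated together with its existence.
\<close>

definition mat_inv :: "'a :: field mat \<Rightarrow> 'a mat" where
  "mat_inv M = the (mat_inverse M)"

lemma inverts_mat_mat_inv:
  fixes M :: "'a :: field mat"
  assumes "invertible_mat M"
  shows "inverts_mat M (mat_inv M)" "inverts_mat (mat_inv M) M"
    "mat_inv M \<in> carrier_mat (dim_row M) (dim_row M)"
proof -
  define n where "n = dim_row M"
  have M: "M \<in> carrier_mat n n"
    using assms by (auto simp: invertible_mat_def n_def)
  obtain B where B: "M * B = 1\<^sub>m n" "B * M = 1\<^sub>m (dim_row B)"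
    using assms by (auto simp: invertible_mat_def inverts_mat_def n_def)
  have "dim_col B = n" "dim_row B = n"
    using arg_cong[OF B(1), of dim_col] arg_cong[OF B(2), of dim_col] M by auto
  with B M have "M \<in> Units (ring_mat TYPE('a) n ())"
    by (auto simp: Units_def ring_mat_def intro!: bexI[of _ B])
  then obtain N where N: "mat_inverse M = Some N"
    using mat_inverse(1)[OF M, where b = "()"] by (cases "mat_inverse M") auto
  note * = mat_inverse(2)[OF M N]
  show "inverts_mat M (mat_inv M)" "inverts_mat (mat_inv M) M"
    "mat_inv M \<in> carrier_mat (dim_row M) (dim_row M)"
    using * M N by (auto simp: inverts_mat_def mat_inv_def)
qed

definition append_cols :: "'a :: zero mat \<Rightarrow> 'a mat \<Rightarrow> 'a mat" (infixr "@\<^sub>c" 65) where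
  "M @\<^sub>c N = four_block_mat M N (0\<^sub>m 0 (dim_col M)) (0\<^sub>m 0 (dim_col N))"

text \<open>
  The map \<open>R\<close> of the closed loop \<open>\<eta> = R \<eta> + d\<close> with \<open>\<eta> = (x, u, y)\<close>:
  the leading block of the outer \<open>four_block_mat\<close> acts on \<open>(x, u)\<close>, the trailing one on \<open>y\<close>.
\<close>

definition closed_loop_map ::
    "nat \<Rightarrow> nat \<Rightarrow> nat \<Rightarrow> tf mat \<Rightarrow> tf mat \<Rightarrow> tf mat \<Rightarrow> tf mat \<Rightarrow> tf mat \<Rightarrow> tf mat" where
  "closed_loop_map n m p A B C D K =
     four_block_mat
       (four_block_mat (A + (1 - tf_z) \<cdot>\<^sub>m 1\<^sub>m n) B
                       (0\<^sub>m m n)                    (0\<^sub>m m m))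
       (0\<^sub>m n p @\<^sub>r K)
       (C @\<^sub>c D)
       (0\<^sub>m p p)"

text \<open>Only proper controllers are admissible, hence the first conjunct.\<close>

definition internally_stabilizes ::
    "nat \<Rightarrow> nat \<Rightarrow> nat \<Rightarrow> tf mat \<Rightarrow> tf mat \<Rightarrow> tf mat \<Rightarrow> tf mat \<Rightarrow> tf mat \<Rightarrow> bool" where
  "internally_stabilizes n m p A B C D K \<longleftrightarrow>
     K \<in> proper_mats m p \<and>
     invertible_mat (1\<^sub>m (n + m + p) - closed_loop_map n m p A B C D K) \<and>
     mat_inv (1\<^sub>m (n + m + p) - closed_loop_map n m p A B C D K)
       \<in> RHinf (n + m + p) (n + m + p)"

end

theory Submission
  imports Defs "Jordan_Normal_Form.Determinant"
begin

text \<open>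
  The nominal closed loop has an explicit inverse. Write \<open>Q\<close> for the nominal \<open>I - R(0)\<close>. A
  disturbance \<open>d_u\<close> added to the control acts on the loop like the state disturbance
  \<open>B d_u\<close> together with the measurement disturbance \<open>D d_u\<close>, so every entry of \<open>Q\<inverse>\<close> is built
  from constants and the four blocks of \<open>Phi\<close> by sums and products, and \<open>Q\<inverse>\<close> is stable and proper.
  That the nominal controller really produces the responses in \<open>Phi\<close> is the identity
  \<open>[Phi_ux Phi_uy] = K ([C D] Phi + [0 I])\<close> (lemma \<open>controller_realizes_responses\<close>); the
  inverse is verified in \<open>return_difference_mult_closed_loop_inverse\<close>.

  The plant perturbation enters only the state and measurement equations and sees only
  the state and the control. So the perturbed \<open>I - R(Delta)\<close> is \<open>Q - X Delta L\<close> with a constant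
  inclusion \<open>X\<close> of the state and measurement coordinates and a constant projection \<open>L\<close> onto the
  state and control coordinates, and \<open>L Q\<inverse> X = Phi\<close>
  (\<open>closed_loop_inverse_compression\<close>). The Woodbury identities
    \<open>(Q - X Delta L)\<inverse> = Q\<inverse> + Q\<inverse> X Psi Delta L Q\<inverse>\<close> and
    \<open>Psi = I + Delta L (Q - X Delta L)\<inverse> X\<close>
  then turn a stable proper \<open>Psi\<close> into a stable proper closed loop and back, because the stable
  proper functions form a ring (\<open>stable_inverse_perturbation_iff\<close>).

  It remains to see that \<open>Phi_xx\<close> is invertible and \<open>K\<close> is proper. As \<open>(I + D K0)\<inverse>\<close> is
  proper by assumption, properness of \<open>K0\<close> is what has to be shown. The first affine constraint reads
  \<open>z Phi_xx = I + A Phi_xx + B Phi_ux\<close>, a strictly proper perturbation of the identity. Its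
  determinant is \<open>1\<close> modulo strictly proper functions, hence a unit among the proper ones, so
  \<open>z Phi_xx\<close> has a proper inverse; the \<open>z\<close> that this leaves in \<open>Phi_xx\<inverse>\<close> is absorbed by
  the strictly proper \<open>Phi_ux\<close>.
\<close>

section \<open>Proper and stable rational functions\<close>

lemma fract_eq_quot_of_fract:
  fixes f :: tf
  shows "f = to_fract (fst (quot_of_fract f)) / to_fract (snd (quot_of_fract f))"
  by (metis Fract_conv_to_fract Fract_quot_of_fract)

text \<open>
  Compares an arbitrary representation of a fraction with the one in lowest terms; this is what
  frees properness and stability from lowest terms in \<open>tf_proper_iff\<close> and \<open>tf_stable_iff\<close>.
\<close>

lemma quot_of_fract_cross:
  fixes a b :: "real poly"
  assumes "b \<noteq> 0" and "f = to_fract a / to_fract b"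
  shows "fst (quot_of_fract f) * b = a * snd (quot_of_fract f)"
proof -
  have "to_fract a / to_fract b
      = to_fract (fst (quot_of_fract f)) / to_fract (snd (quot_of_fract f))"
    using assms(2) fract_eq_quot_of_fract[of f] by simp
  then have "to_fract (fst (quot_of_fract f) * b) = to_fract (a * snd (quot_of_fract f))"
    using assms(1) by (simp add: field_simps)
  then show ?thesis
    unfolding to_fract_eq_iff .
qed

text \<open>
  Cross multiplication preserves the relative degree, so any representation of a fraction
  decides properness. Sums and products can then be handled without cancelling common factors.
\<close>

lemma tf_proper_iff:
  "tf_proper f \<longleftrightarrow>
    (\<exists>a b. b \<noteq> 0 \<and> f = to_fract a / to_fract b \<and> degree a \<le> degree b)"
proof
  assume "tf_proper f"
  then show "\<exists>a b. b \<noteq> 0 \<and> f = to_fract a / to_fract b \<and> degree a \<le> degree b"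
    unfolding tf_proper_def using fract_eq_quot_of_fract snd_quot_of_fract_nonzero by blast
next
  assume "\<exists>a b. b \<noteq> 0 \<and> f = to_fract a / to_fract b \<and> degree a \<le> degree b"
  then obtain a b where ab: "b \<noteq> 0" "f = to_fract a / to_fract b" "degree a \<le> degree b"
    by blast
  note eq = quot_of_fract_cross[OF ab(1,2)]
  show "tf_proper f"
  proof (cases "f = 0")
    case True
    then show ?thesis by (simp add: tf_proper_def)
  next
    case False
    then have "a \<noteq> 0" using ab(2) by auto
    moreover have "fst (quot_of_fract f) \<noteq> 0"
      using False by simp
    moreover have "snd (quot_of_fract f) \<noteq> 0" by simp
    ultimately have "degree (fst (quot_of_fract f)) + degree b
        = degree a + degree (snd (quot_of_fract f))"
      using arg_cong[OF eq, of degree] ab(1) by (simp add: degree_mult_eq)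
    then show ?thesis
      using ab(3) by (simp add: tf_proper_def)
  qed
qed

definition schur_stable_poly :: "real poly \<Rightarrow> bool" where
  "schur_stable_poly b \<longleftrightarrow> (\<forall>w. poly (map_poly complex_of_real b) w = 0 \<longrightarrow> norm w < 1)"

lemma map_poly_of_real_mult:
  "map_poly complex_of_real (a * b) = map_poly complex_of_real a * map_poly complex_of_real b"
  by (intro poly_eqI) (simp add: coeff_map_poly coeff_mult)

lemma schur_stable_poly_mult:
  "schur_stable_poly (a * b) \<longleftrightarrow> schur_stable_poly a \<and> schur_stable_poly b"
  unfolding schur_stable_poly_def map_poly_of_real_mult by auto

lemma schur_stable_poly_1: "schur_stable_poly 1"
  unfolding schur_stable_poly_def by simp

text \<open>
  The denominator in lowest terms divides every other denominator, so its roots are among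
  theirs. Only the existence of a good denominator is equivalent to stability: a common
  factor may have unstable roots.
\<close>

lemma tf_stable_iff:
  "tf_stable f \<longleftrightarrow>
    (\<exists>a b. b \<noteq> 0 \<and> f = to_fract a / to_fract b \<and> schur_stable_poly b)"
proof
  assume "tf_stable f"
  then have "schur_stable_poly (snd (quot_of_fract f))"
    by (simp add: tf_stable_def tf_poles_def schur_stable_poly_def)
  then show "\<exists>a b. b \<noteq> 0 \<and> f = to_fract a / to_fract b \<and> schur_stable_poly b"
    using fract_eq_quot_of_fract snd_quot_of_fract_nonzero by blast
next
  assume "\<exists>a b. b \<noteq> 0 \<and> f = to_fract a / to_fract b \<and> schur_stable_poly b"
  then obtain a b where ab: "b \<noteq> 0" "f = to_fract a / to_fract b" "schur_stable_poly b"
    by blast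
  have "snd (quot_of_fract f) dvd fst (quot_of_fract f) * b"
    using quot_of_fract_cross[OF ab(1,2)] by simp
  then have "snd (quot_of_fract f) dvd b"
    using coprime_quot_of_fract[of f] by (simp add: coprime_commute coprime_dvd_mult_right_iff)
  then have "schur_stable_poly (snd (quot_of_fract f))"
    using ab(3) schur_stable_poly_mult by (auto elim!: dvdE)
  then show "tf_stable f"
    by (simp add: tf_stable_def tf_poles_def schur_stable_poly_def)
qed

lemma tf_proper_add:
  assumes "tf_proper f" "tf_proper g" shows "tf_proper (f + g)"
proof -
  obtain a b c d where "b \<noteq> 0" "f = to_fract a / to_fract b" "degree a \<le> degree b"
    "d \<noteq> 0" "g = to_fract c / to_fract d" "degree c \<le> degree d"
    using assms unfolding tf_proper_iff by blast
  moreover from this have "degree (a * d + c * b) \<le> degree (b * d)"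
    by (intro degree_add_le) (auto simp: degree_mult_eq intro: order.trans[OF degree_mult_le])
  ultimately show ?thesis
    unfolding tf_proper_iff
    by (intro exI[of _ "a * d + c * b"] exI[of _ "b * d"]) (simp add: field_simps)
qed

lemma tf_proper_mult:
  assumes "tf_proper f" "tf_proper g" shows "tf_proper (f * g)"
proof -
  obtain a b c d where "b \<noteq> 0" "f = to_fract a / to_fract b" "degree a \<le> degree b"
    "d \<noteq> 0" "g = to_fract c / to_fract d" "degree c \<le> degree d"
    using assms unfolding tf_proper_iff by blast
  moreover from this have "degree (a * c) \<le> degree (b * d)"
    by (auto simp: degree_mult_eq intro: order.trans[OF degree_mult_le])
  ultimately show ?thesis
    unfolding tf_proper_iff
    by (intro exI[of _ "a * c"] exI[of _ "b * d"]) simp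
qed

lemma tf_stable_add:
  assumes "tf_stable f" "tf_stable g" shows "tf_stable (f + g)"
proof -
  obtain a b c d where "b \<noteq> 0" "f = to_fract a / to_fract b" "schur_stable_poly b"
    "d \<noteq> 0" "g = to_fract c / to_fract d" "schur_stable_poly d"
    using assms unfolding tf_stable_iff by blast
  then show ?thesis
    unfolding tf_stable_iff
    by (intro exI[of _ "a * d + c * b"] exI[of _ "b * d"])
      (simp add: field_simps schur_stable_poly_mult)
qed

lemma tf_stable_mult:
  assumes "tf_stable f" "tf_stable g" shows "tf_stable (f * g)"
proof -
  obtain a b c d where "b \<noteq> 0" "f = to_fract a / to_fract b" "schur_stable_poly b"
    "d \<noteq> 0" "g = to_fract c / to_fract d" "schur_stable_poly d"
    using assms unfolding tf_stable_iff by blast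
  then show ?thesis
    unfolding tf_stable_iff
    by (intro exI[of _ "a * c"] exI[of _ "b * d"]) (simp add: schur_stable_poly_mult)
qed

lemma tf_const: "tf_proper (to_fract [:c:])" "tf_stable (to_fract [:c:])"
proof -
  show "tf_proper (to_fract [:c:])"
    unfolding tf_proper_iff by (intro exI[of _ "[:c:]"] exI[of _ 1]) simp
  show "tf_stable (to_fract [:c:])"
    unfolding tf_stable_iff
    by (intro exI[of _ "[:c:]"] exI[of _ 1]) (simp add: schur_stable_poly_1)
qed

lemma tf_z_nonzero: "tf_z \<noteq> 0"
  by (simp add: tf_z_def)

lemma tf_inverse_z: "tf_proper (inverse tf_z)" "tf_stable (inverse tf_z)"
proof -
  show "tf_proper (inverse tf_z)"
    unfolding tf_proper_iff tf_z_def
    by (intro exI[of _ 1] exI[of _ "[:0, 1:]"]) (simp add: inverse_eq_divide)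
  show "tf_stable (inverse tf_z)"
    unfolding tf_stable_iff tf_z_def
    by (intro exI[of _ 1] exI[of _ "[:0, 1:]"])
      (simp add: inverse_eq_divide schur_stable_poly_def map_poly_pCons)
qed

text \<open>
  If \<open>f - 1\<close> is strictly proper, that is \<open>z (f - 1) = a / b\<close> is proper, then
  \<open>f = (z b + a) / (z b)\<close>, where \<open>a\<close> does not affect the degree of the numerator.
\<close>

lemma tf_proper_inverse:
  assumes "tf_proper (tf_z * (f - 1))"
  shows "f \<noteq> 0" and "tf_proper (inverse f)"
proof -
  define z :: "real poly" where "z = [:0, 1:]"
  obtain a b where ab: "b \<noteq> 0" "tf_z * (f - 1) = to_fract a / to_fract b"
      "degree a \<le> degree b"
    using assms unfolding tf_proper_iff by blast
  have z: "z \<noteq> 0" "degree z = 1" "tf_z = to_fract z" by (simp_all add: z_def tf_z_def)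
  have f: "f = to_fract (z * b + a) / to_fract (z * b)"
  proof -
    have "f = 1 + tf_z * (f - 1) / tf_z" using tf_z_nonzero by simp
    also have "\<dots> = 1 + to_fract a / to_fract b / to_fract z" by (simp only: ab(2) z(3)[symmetric])
    finally show ?thesis using ab(1) z(1) by (simp add: field_simps)
  qed
  have "degree a < degree (z * b)"
    using ab(1,3) z by (simp add: degree_mult_eq)
  then have deg: "degree (z * b + a) = degree (z * b)"
    by (rule degree_add_eq_left)
  then have nz: "z * b + a \<noteq> 0"
    using \<open>degree a < degree (z * b)\<close> by auto
  show "f \<noteq> 0"
    using nz ab(1) z by (simp add: f del: to_fract_add to_fract_mult)
  show "tf_proper (inverse f)"
    unfolding tf_proper_iff
    using nz deg
    by (intro exI[of _ "z * b"] exI[of _ "z * b + a"])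
      (simp add: f inverse_divide)
qed

section \<open>Matrices over a subring\<close>

text \<open>
  Proper functions and stable proper functions are subrings of the same field of fractions;
  the locale transfers closure properties to matrices for both at once.
\<close>

locale subring_of =
  fixes S :: "'a :: comm_ring_1 set"
  assumes zero_closed: "0 \<in> S" and one_closed: "1 \<in> S"
    and add_closed: "a \<in> S \<Longrightarrow> b \<in> S \<Longrightarrow> a + b \<in> S"
    and mult_closed: "a \<in> S \<Longrightarrow> b \<in> S \<Longrightarrow> a * b \<in> S"
    and uminus_closed: "a \<in> S \<Longrightarrow> - a \<in> S"
begin

definition mats :: "nat \<Rightarrow> nat \<Rightarrow> 'a mat set" where
  "mats r c = {M \<in> carrier_mat r c. \<forall>i<r. \<forall>j<c. M $$ (i, j) \<in> S}"

lemma mats_carrier: "M \<in> mats r c \<Longrightarrow> M \<in> carrier_mat r c"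
  by (simp add: mats_def)

lemma minus_closed: "a \<in> S \<Longrightarrow> b \<in> S \<Longrightarrow> a - b \<in> S"
  using add_closed[of a "- b"] uminus_closed by simp

lemma sum_closed: "(\<And>x. x \<in> X \<Longrightarrow> f x \<in> S) \<Longrightarrow> sum f X \<in> S"
  by (induction X rule: infinite_finite_induct) (auto intro: zero_closed add_closed)

lemma prod_closed: "(\<And>x. x \<in> X \<Longrightarrow> f x \<in> S) \<Longrightarrow> prod f X \<in> S"
  by (induction X rule: infinite_finite_induct) (auto intro: one_closed mult_closed)

lemma signof_closed: "signof q \<in> S"
  by (auto simp: sign_def intro: one_closed uminus_closed)

lemma mats_add: "M \<in> mats r c \<Longrightarrow> N \<in> mats r c \<Longrightarrow> M + N \<in> mats r c"
  by (auto simp: mats_def intro!: add_closed)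

lemma mats_minus: "M \<in> mats r c \<Longrightarrow> N \<in> mats r c \<Longrightarrow> M - N \<in> mats r c"
  by (auto simp: mats_def intro!: minus_closed)

lemma mats_smult: "a \<in> S \<Longrightarrow> M \<in> mats r c \<Longrightarrow> a \<cdot>\<^sub>m M \<in> mats r c"
  by (auto simp: mats_def intro!: mult_closed)

lemma mats_mult: "M \<in> mats r c \<Longrightarrow> N \<in> mats c d \<Longrightarrow> M * N \<in> mats r d"
  by (auto simp: mats_def scalar_prod_def intro!: sum_closed mult_closed)

lemma mats_0: "0\<^sub>m r c \<in> mats r c" and mats_1: "1\<^sub>m r \<in> mats r r"
  by (auto simp: mats_def intro: zero_closed one_closed)

lemma mats_four_block:
  "M1 \<in> mats r1 c1 \<Longrightarrow> M2 \<in> mats r1 c2 \<Longrightarrow> M3 \<in> mats r2 c1 \<Longrightarrow> M4 \<in> mats r2 c2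
    \<Longrightarrow> four_block_mat M1 M2 M3 M4 \<in> mats (r1 + r2) (c1 + c2)"
  by (auto simp: mats_def)

lemma mats_append_rows: "M \<in> mats r1 c \<Longrightarrow> N \<in> mats r2 c \<Longrightarrow> M @\<^sub>r N \<in> mats (r1 + r2) c"
  using mats_four_block[of M r1 c "0\<^sub>m r1 0" 0 N r2 "0\<^sub>m r2 0"] mats_0
  by (auto simp: append_rows_def dest: mats_carrier)

lemma mats_append_cols: "M \<in> mats r c1 \<Longrightarrow> N \<in> mats r c2 \<Longrightarrow> M @\<^sub>c N \<in> mats r (c1 + c2)"
  using mats_four_block[of M r c1 N c2 "0\<^sub>m 0 c1" 0 "0\<^sub>m 0 c2"] mats_0
  by (auto simp: append_cols_def dest: mats_carrier)

lemma det_closed: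
  assumes "M \<in> mats r r" shows "det M \<in> S"
proof -
  have "det M = (\<Sum>q | q permutes {0..<r}. signof q * (\<Prod>i = 0..<r. M $$ (i, q i)))"
    using assms by (simp add: mats_def det_def')
  also have "\<dots> \<in> S"
  proof (intro sum_closed mult_closed prod_closed signof_closed)
    fix q i assume "q \<in> {q. q permutes {0..<r}}" "i \<in> {0..<r}"
    then have "i < r" "q i < r" using permutes_in_image[of q "{0..<r}" i] by auto
    then show "M $$ (i, q i) \<in> S" using assms by (auto simp: mats_def)
  qed
  finally show ?thesis .
qed

lemma mats_adj_mat:
  assumes M: "M \<in> mats r r" shows "adj_mat M \<in> mats r r"
proof -
  have "mat_delete M i j \<in> mats (r - 1) (r - 1)" if "i < r" "j < r" for i j
    using M that by (auto simp: mats_def mat_delete_def)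
  moreover have "(- 1) ^ k \<in> S" for k
    using one_closed uminus_closed by (cases "even k") auto
  ultimately have "cofactor M i j \<in> S" if "i < r" "j < r" for i j
    unfolding cofactor_def using that det_closed mult_closed by blast
  then show ?thesis
    using M by (auto simp: mats_def adj_mat_def)
qed

text \<open>
  The determinant is a polynomial in the entries, so it respects congruence modulo an ideal.
  Since \<open>J\<close> is an ideal of the subring \<open>S\<close> and not of the ambient ring, reduction modulo \<open>J\<close>
  is not a homomorphism on the whole type; the congruence is therefore carried through the
  sum over permutations and the products directly.
\<close>

lemma det_cong_1_mod_ideal:
  assumes J: "J \<subseteq> S" "0 \<in> J" "\<And>a b. a \<in> J \<Longrightarrow> b \<in> J \<Longrightarrow> a + b \<in> J"
      "\<And>a b. a \<in> S \<Longrightarrow> b \<in> J \<Longrightarrow> a * b \<in> J"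
    and N: "N \<in> carrier_mat r r" "\<And>i j. i < r \<Longrightarrow> j < r \<Longrightarrow> N $$ (i, j) \<in> J"
  shows "det (1\<^sub>m r + N) - 1 \<in> J"
proof -
  define R where "R = (\<lambda>a b. a \<in> S \<and> b \<in> S \<and> a - b \<in> J)"
  have R_add: "R (a + c) (b + d)" if "R a b" "R c d" for a b c d
  proof -
    have "(a + c) - (b + d) = (a - b) + (c - d)" by simp
    then show ?thesis using that J(3) add_closed unfolding R_def by metis
  qed
  have R_mult: "R (a * c) (b * d)" if "R a b" "R c d" for a b c d
  proof -
    \<comment> \<open>Both summands lie in the ideal only because \<open>c\<close> and \<open>b\<close> lie in \<open>S\<close>.\<close>
    have "a * c - b * d = c * (a - b) + b * (c - d)" by (simp add: algebra_simps)
    then show ?thesis using that J(3,4) mult_closed unfolding R_def by metis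
  qed
  have R_refl: "R a a" if "a \<in> S" for a using that J(2) by (simp add: R_def)
  have entry: "R ((1\<^sub>m r + N) $$ (i, j)) (1\<^sub>m r $$ (i, j))" if "i < r" "j < r" for i j
  proof -
    have "N $$ (i, j) \<in> S" using that N(2) J(1) by auto
    then show ?thesis
      using that N by (auto simp: R_def zero_closed one_closed add_closed)
  qed
  have "R (\<Sum>q | q permutes {0..<r}. signof q * (\<Prod>i = 0..<r. (1\<^sub>m r + N) $$ (i, q i)))
          (\<Sum>q | q permutes {0..<r}. signof q * (\<Prod>i = 0..<r. 1\<^sub>m r $$ (i, q i)))"
  proof (rule sum.related[of R])
    show "R 0 0" using R_refl zero_closed .
    show "\<forall>a c b d. R a b \<and> R c d \<longrightarrow> R (a + c) (b + d)" using R_add by blast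
    show "finite {q. q permutes {0..<r}}" by (simp add: finite_permutations)
    show "\<forall>q\<in>{q. q permutes {0..<r}}.
        R (signof q * (\<Prod>i = 0..<r. (1\<^sub>m r + N) $$ (i, q i)))
          (signof q * (\<Prod>i = 0..<r. 1\<^sub>m r $$ (i, q i)))"
    proof (intro ballI R_mult R_refl signof_closed)
      fix q assume "q \<in> {q. q permutes {0..<r}}"
      then have lt: "q i < r" if "i < r" for i
        using permutes_in_image[of q "{0..<r}" i] that by auto
      show "R (\<Prod>i = 0..<r. (1\<^sub>m r + N) $$ (i, q i)) (\<Prod>i = 0..<r. 1\<^sub>m r $$ (i, q i))"
      proof (rule prod.related[of R])
        show "R 1 1" using R_refl one_closed .
        show "\<forall>a c b d. R a b \<and> R c d \<longrightarrow> R (a * c) (b * d)" using R_mult by blast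
      qed (use entry lt in auto)
    qed
  qed
  moreover have "det (1\<^sub>m r + N) =
      (\<Sum>q | q permutes {0..<r}. signof q * (\<Prod>i = 0..<r. (1\<^sub>m r + N) $$ (i, q i)))"
    using N(1) by (intro det_def') simp
  moreover have "(1 :: 'a) =
      (\<Sum>q | q permutes {0..<r}. signof q * (\<Prod>i = 0..<r. 1\<^sub>m r $$ (i, q i)))"
    using det_def'[of "1\<^sub>m r :: 'a mat" r] by simp
  ultimately have "R (det (1\<^sub>m r + N)) 1" by metis
  then show ?thesis by (simp add: R_def)
qed

end

section \<open>Transfer matrices and strictly proper perturbations of the identity\<close>

text \<open>
  For square matrices over a field a right inverse determines \<open>mat_inv\<close>, so it is enough
  below to verify one product.
\<close>

lemma mat_inv_eqI:
  fixes M :: "'a :: field mat"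
  assumes M: "M \<in> carrier_mat n n" and W: "W \<in> carrier_mat n n" and MW: "M * W = 1\<^sub>m n"
  shows "invertible_mat M" "mat_inv M = W"
proof -
  have WM: "W * M = 1\<^sub>m n" by (rule mat_mult_left_right_inverse[OF M W MW])
  show inv: "invertible_mat M"
    using assms WM unfolding invertible_mat_def inverts_mat_def by auto
  have V: "M * mat_inv M = 1\<^sub>m n" "mat_inv M \<in> carrier_mat n n"
    using inverts_mat_mat_inv[OF inv] M by (auto simp: inverts_mat_def)
  have "mat_inv M = (W * M) * mat_inv M" using V WM by simp
  also have "\<dots> = W * (M * mat_inv M)" using M W V by (intro assoc_mult_mat) auto
  finally show "mat_inv M = W" using V W by simp
qed

lemma mat_invD:
  fixes M :: "'a :: field mat"
  assumes "invertible_mat M" and M: "M \<in> carrier_mat n n"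
  shows "mat_inv M \<in> carrier_mat n n" "M * mat_inv M = 1\<^sub>m n" "mat_inv M * M = 1\<^sub>m n"
  using inverts_mat_mat_inv[OF assms(1)] M by (auto simp: inverts_mat_def)

interpretation proper: subring_of "Collect tf_proper"
  rewrites "proper.mats = proper_mats"
proof -
  have minus_1: "to_fract [:- 1 :: real:] = - 1"
    by (simp flip: to_fract_1 to_fract_uminus add: one_pCons)
  have one: "tf_proper 1" "tf_proper 0" "tf_proper (- 1)"
    using tf_const(1)[of 1] tf_const(1)[of 0] tf_const(1)[of "- 1"] minus_1
    by (simp_all flip: one_pCons)
  show "subring_of (Collect tf_proper)"
    using one tf_proper_add tf_proper_mult tf_proper_mult[OF one(3)]
    by unfold_locales auto
  then show "subring_of.mats (Collect tf_proper) = proper_mats"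
    by (intro ext) (simp add: subring_of.mats_def proper_mats_def)
qed

interpretation RHinf: subring_of "{f. tf_proper f \<and> tf_stable f}"
  rewrites "RHinf.mats = RHinf"
proof -
  have minus_1: "to_fract [:- 1 :: real:] = - 1"
    by (simp flip: to_fract_1 to_fract_uminus add: one_pCons)
  have one: "tf_stable 1" "tf_stable 0" "tf_stable (- 1)"
    using tf_const(2)[of 1] tf_const(2)[of 0] tf_const(2)[of "- 1"] minus_1
    by (simp_all flip: one_pCons)
  show "subring_of {f. tf_proper f \<and> tf_stable f}"
    using one tf_stable_add tf_stable_mult tf_stable_mult[OF one(3)]
     proper.zero_closed proper.one_closed proper.add_closed proper.mult_closed proper.uminus_closed
    by unfold_locales auto
  then show "subring_of.mats {f. tf_proper f \<and> tf_stable f} = RHinf"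
    by (intro ext) (simp add: subring_of.mats_def RHinf_def)
qed

lemma proper_of_strictly_proper: "tf_proper (tf_z * f) \<Longrightarrow> tf_proper f"
  using tf_proper_mult[OF tf_inverse_z(1), of "tf_z * f"] tf_z_nonzero
  by (simp flip: mult.assoc)

text \<open>
  Strictly proper functions form an ideal of the proper ones, and \<open>1\<close> plus a strictly proper
  function has a proper inverse. So the determinant of the matrix is invertible among proper
  functions, and Cramer's rule gives a proper inverse matrix.
\<close>

lemma proper_inverse_of_strictly_proper_perturbation:
  assumes N: "tf_z \<cdot>\<^sub>m N \<in> proper_mats r r"
  obtains W where "W \<in> proper_mats r r" "(1\<^sub>m r + N) * W = 1\<^sub>m r"
proof -
  define M where "M = 1\<^sub>m r + N"
  have Nc: "N \<in> carrier_mat r r"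
    using carrier_matD[OF proper.mats_carrier[OF N]] by (intro carrier_matI) simp_all
  have N': "tf_proper (tf_z * N $$ (i, j))" if "i < r" "j < r" for i j
    using N Nc that by (auto simp: proper_mats_def)
  have "N \<in> proper_mats r r"
    using Nc N' proper_of_strictly_proper by (auto simp: proper_mats_def)
  then have M: "M \<in> proper_mats r r"
    unfolding M_def by (intro proper.mats_add proper.mats_1)
  have Mc: "M \<in> carrier_mat r r" using M by (rule proper.mats_carrier)
  have "det M - 1 \<in> {f. tf_proper (tf_z * f)}"
    unfolding M_def
  proof (rule proper.det_cong_1_mod_ideal)
    show "a * b \<in> {f. tf_proper (tf_z * f)}"
      if "a \<in> Collect tf_proper" "b \<in> {f. tf_proper (tf_z * f)}" for a b
      using that tf_proper_mult[of a "tf_z * b"] by (simp add: mult.left_commute)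
  qed (use Nc N' proper_of_strictly_proper proper.zero_closed in
      \<open>auto simp: distrib_left intro: tf_proper_add\<close>)
  then have det: "det M \<noteq> 0" "tf_proper (inverse (det M))"
    using tf_proper_inverse[of "det M"] by auto
  show ?thesis
  proof
    show "inverse (det M) \<cdot>\<^sub>m adj_mat M \<in> proper_mats r r"
      using det M by (intro proper.mats_smult proper.mats_adj_mat) auto
    have "M * (inverse (det M) \<cdot>\<^sub>m adj_mat M) = inverse (det M) \<cdot>\<^sub>m (det M \<cdot>\<^sub>m 1\<^sub>m r)"
      using adj_mat[OF Mc] Mc by (simp add: mult_smult_distrib)
    also have "\<dots> = 1\<^sub>m r" using det(1) by (intro eq_matI) auto
    finally show "(1\<^sub>m r + N) * (inverse (det M) \<cdot>\<^sub>m adj_mat M) = 1\<^sub>m r"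
      by (simp add: M_def)
  qed
qed

lemma zinv_RHinfD:
  assumes "F \<in> zinv_RHinf r c"
  shows "tf_z \<cdot>\<^sub>m F \<in> RHinf r c" "F \<in> RHinf r c"
proof -
  obtain G where G: "F = inverse tf_z \<cdot>\<^sub>m G" "G \<in> RHinf r c"
    using assms by (auto simp: zinv_RHinf_def)
  have "tf_z \<cdot>\<^sub>m F = G"
    unfolding G(1) using tf_z_nonzero by (intro eq_matI) auto
  then show "tf_z \<cdot>\<^sub>m F \<in> RHinf r c" using G(2) by simp
  show "F \<in> RHinf r c"
    unfolding G(1) using G(2) tf_inverse_z by (intro RHinf.mats_smult) auto
qed

lemma const_tf_mat_RHinf: "M \<in> carrier_mat r c \<Longrightarrow> const_tf_mat M \<in> RHinf r c"
  by (auto simp: const_tf_mat_def RHinf_def tf_const)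

lemma RHinf_subset_proper_mats: "RHinf r c \<subseteq> proper_mats r c"
  by (auto simp: RHinf_def proper_mats_def)

section \<open>Block matrix algebra\<close>

text \<open>
  The matrix laws are restated with conditions on dimensions. Unlike membership in a
  carrier with unknown dimensions, such conditions leave no free variables, so the
  simplifier can normalize noncommutative matrix expressions with them.
\<close>

lemma mult_assoc_dim:
  "dim_col A = dim_row B \<Longrightarrow> dim_col B = dim_row C \<Longrightarrow> (A * B) * C = A * (B * C)"
  for A B C :: "'a :: comm_ring_1 mat"
  by (rule assoc_mult_mat) auto

lemma distrib_dim:
  fixes A B C :: "'a :: comm_ring_1 mat"
  shows "dim_row A = dim_row B \<Longrightarrow> dim_col A = dim_col B \<Longrightarrow> dim_col A = dim_row C
      \<Longrightarrow> (A + B) * C = A * C + B * C"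
    and "dim_col A = dim_row B \<Longrightarrow> dim_row B = dim_row C \<Longrightarrow> dim_col B = dim_col C
      \<Longrightarrow> A * (B + C) = A * B + A * C"
  by (rule add_mult_distrib_mat mult_add_distrib_mat; auto)+

lemma uminus_dim:
  fixes A B :: "'a :: comm_ring_1 mat"
  shows "dim_col A = dim_row B \<Longrightarrow> (- A) * B = - (A * B)"
    and "dim_col A = dim_row B \<Longrightarrow> A * (- B) = - (A * B)"
    and "- (- A) = A"
    and "dim_row A = dim_row B \<Longrightarrow> dim_col A = dim_col B \<Longrightarrow> - (A + B) = - A + - B"
    and "dim_row A = dim_row B \<Longrightarrow> dim_col A = dim_col B \<Longrightarrow> A - B = A + - B"
    and "- (0\<^sub>m r c) = (0\<^sub>m r c :: 'a mat)"
  by (auto intro!: eq_matI)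

lemma add_dim:
  fixes A B C :: "'a :: comm_ring_1 mat"
  shows "dim_row A = dim_row B \<Longrightarrow> dim_col A = dim_col B \<Longrightarrow> A + B = B + A"
    and "dim_row A = dim_row B \<Longrightarrow> dim_col A = dim_col B \<Longrightarrow> dim_row B = dim_row C
      \<Longrightarrow> dim_col B = dim_col C \<Longrightarrow> (A + B) + C = A + (B + C)"
    and "dim_row A = dim_row B \<Longrightarrow> dim_col A = dim_col B \<Longrightarrow> dim_row B = dim_row C
      \<Longrightarrow> dim_col B = dim_col C \<Longrightarrow> A + (B + C) = B + (A + C)"
    and "dim_row A = r \<Longrightarrow> dim_col A = c \<Longrightarrow> A + - A = 0\<^sub>m r c"
    and "dim_row A = dim_row B \<Longrightarrow> dim_col A = dim_col B \<Longrightarrow> A + (- A + B) = B"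
    and "dim_row A = dim_row B \<Longrightarrow> dim_col A = dim_col B \<Longrightarrow> - A + (A + B) = B"
    and "dim_row A = dim_row B \<Longrightarrow> dim_col A = dim_col B \<Longrightarrow> A + (B + - A) = B"
    and "dim_row A = r \<Longrightarrow> dim_col A = c \<Longrightarrow> A + 0\<^sub>m r c = A"
    and "dim_row A = r \<Longrightarrow> dim_col A = c \<Longrightarrow> 0\<^sub>m r c + A = A"
  by (auto intro!: eq_matI simp: algebra_simps)

lemma unit_dim:
  fixes A :: "'a :: comm_ring_1 mat"
  shows "dim_row A = n \<Longrightarrow> 1\<^sub>m n * A = A" and "dim_col A = n \<Longrightarrow> A * 1\<^sub>m n = A"
    and "dim_row A = n \<Longrightarrow> 0\<^sub>m k n * A = 0\<^sub>m k (dim_col A)"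
    and "dim_col A = n \<Longrightarrow> A * 0\<^sub>m n k = 0\<^sub>m (dim_row A) k"
  by (auto intro!: eq_matI)

lemma add_uminus_dim: "dim_row A = r \<Longrightarrow> dim_col A = c \<Longrightarrow> - A + A = 0\<^sub>m r c"
  for A :: "'a :: comm_ring_1 mat"
  by (auto intro!: eq_matI)

lemmas mat_algebra =
  mult_assoc_dim distrib_dim uminus_dim add_dim unit_dim add_uminus_dim

lemma append_cols_carrier [simp, intro]:
  "M \<in> carrier_mat r c1 \<Longrightarrow> N \<in> carrier_mat r c2 \<Longrightarrow> M @\<^sub>c N \<in> carrier_mat r (c1 + c2)"
  by (auto simp: append_cols_def)

lemma append_cols_dim [simp]:
  "dim_row (M @\<^sub>c N) = dim_row M" "dim_col (M @\<^sub>c N) = dim_col M + dim_col N"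
  by (auto simp: append_cols_def)

lemma append_rows_dim [simp]:
  "dim_row (M @\<^sub>r N) = dim_row M + dim_row N" "dim_col (M @\<^sub>r N) = dim_col M"
  by (auto simp: append_rows_def)

lemma index_append_rows:
  "i < dim_row M + dim_row N \<Longrightarrow> j < dim_col M \<Longrightarrow>
    (M @\<^sub>r N) $$ (i, j) = (if i < dim_row M then M $$ (i, j) else N $$ (i - dim_row M, j))"
  by (auto simp: append_rows_def)

lemma index_append_cols:
  "i < dim_row M \<Longrightarrow> j < dim_col M + dim_col N \<Longrightarrow>
    (M @\<^sub>c N) $$ (i, j) = (if j < dim_col M then M $$ (i, j) else N $$ (i, j - dim_col M))"
  by (auto simp: append_cols_def)

lemma append_cols_eqD:
  assumes eq: "M @\<^sub>c N = M' @\<^sub>c N'"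
    and dim: "M \<in> carrier_mat r c" "M' \<in> carrier_mat r c"
      "N \<in> carrier_mat r d" "N' \<in> carrier_mat r d"
  shows "M = M'" "N = N'"
proof -
  show "M = M'"
  proof (rule eq_matI)
    fix i j assume "i < dim_row M'" "j < dim_col M'"
    then show "M $$ (i, j) = M' $$ (i, j)"
      using arg_cong[OF eq, of "\<lambda>X. X $$ (i, j)"] dim by (simp add: index_append_cols)
  qed (use dim in auto)
  show "N = N'"
  proof (rule eq_matI)
    fix i j assume "i < dim_row N'" "j < dim_col N'"
    then show "N $$ (i, j) = N' $$ (i, j)"
      using arg_cong[OF eq, of "\<lambda>X. X $$ (i, c + j)"] dim by (simp add: index_append_cols)
  qed (use dim in auto)
qed

lemma append_rows_eqD:
  assumes eq: "M @\<^sub>r N = M' @\<^sub>r N'"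
    and dim: "M \<in> carrier_mat r c" "M' \<in> carrier_mat r c"
      "N \<in> carrier_mat s c" "N' \<in> carrier_mat s c"
  shows "M = M'" "N = N'"
proof -
  show "M = M'"
  proof (rule eq_matI)
    fix i j assume "i < dim_row M'" "j < dim_col M'"
    then show "M $$ (i, j) = M' $$ (i, j)"
      using arg_cong[OF eq, of "\<lambda>X. X $$ (i, j)"] dim by (simp add: index_append_rows)
  qed (use dim in auto)
  show "N = N'"
  proof (rule eq_matI)
    fix i j assume "i < dim_row N'" "j < dim_col N'"
    then show "N $$ (i, j) = N' $$ (i, j)"
      using arg_cong[OF eq, of "\<lambda>X. X $$ (r + i, j)"] dim by (simp add: index_append_rows)
  qed (use dim in auto)
qed

lemma append_cols_mult_append_rows:
  fixes A B :: "'a :: comm_ring_1 mat"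
  assumes "A \<in> carrier_mat r k" "B \<in> carrier_mat r l" "C \<in> carrier_mat k c" "D \<in> carrier_mat l c"
  shows "(A @\<^sub>c B) * (C @\<^sub>r D) = A * C + B * D"
  unfolding append_cols_def append_rows_def using assms
  by (subst mult_four_block_mat[of _ r k _ l _ 0 _ _ c _ 0]) (auto intro!: eq_matI)

lemma append_rows_mult_append_cols:
  fixes A B :: "'a :: comm_ring_1 mat"
  assumes "A \<in> carrier_mat r k" "B \<in> carrier_mat s k" "C \<in> carrier_mat k c" "D \<in> carrier_mat k d"
  shows "(A @\<^sub>r B) * (C @\<^sub>c D) = four_block_mat (A * C) (A * D) (B * C) (B * D)"
  unfolding append_cols_def append_rows_def using assms
  by (subst mult_four_block_mat[of _ r k _ 0 _ s _ _ c _ d]) (auto simp: mat_algebra)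

lemma append_cols_mult_four_block:
  fixes A B :: "'a :: comm_ring_1 mat"
  assumes "A \<in> carrier_mat r k" "B \<in> carrier_mat r l"
    "P \<in> carrier_mat k c" "Q \<in> carrier_mat k d" "R \<in> carrier_mat l c" "S \<in> carrier_mat l d"
  shows "(A @\<^sub>c B) * four_block_mat P Q R S = (A * P + B * R) @\<^sub>c (A * Q + B * S)"
  unfolding append_cols_def using assms
  by (subst mult_four_block_mat[of _ r k _ l _ 0 _ _ c _ d]) (auto simp: mat_algebra)

lemma four_block_mult_append_rows:
  fixes A B :: "'a :: comm_ring_1 mat"
  assumes "A \<in> carrier_mat r k" "B \<in> carrier_mat r l" "C \<in> carrier_mat s k" "D \<in> carrier_mat s l"
    "P \<in> carrier_mat k c" "Q \<in> carrier_mat l c"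
  shows "four_block_mat A B C D * (P @\<^sub>r Q) = (A * P + B * Q) @\<^sub>r (C * P + D * Q)"
  unfolding append_rows_def using assms
  by (subst mult_four_block_mat[of _ r k _ l _ s _ _ c _ 0]) (auto simp: mat_algebra)

section \<open>Woodbury identities\<close>

text \<open>
  Closes both Woodbury computations: there \<open>U = V + R\<close> holds with \<open>U\<close> a factor of \<open>R\<close>, so
  the equation loops as a rewrite rule and has to be applied once.
\<close>

lemma add_sum_cancel:
  fixes M U V R :: "'a :: comm_ring_1 mat"
  assumes "U = V + R" "V \<in> carrier_mat r c" "R \<in> carrier_mat r c" "M \<in> carrier_mat r c"
  shows "M + (U + (- V + - R)) = M"
  unfolding assms(1) using assms(2-) by (auto intro!: eq_matI)

text \<open>
  The hypothesis on \<open>W\<close> says \<open>W = I + Y S X W\<close>; one such unfolding makes all correction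
  terms cancel.
\<close>

lemma woodbury:
  fixes Q S X Y W :: "'a :: comm_ring_1 mat"
  assumes Q: "Q \<in> carrier_mat n n" and S: "S \<in> carrier_mat n n"
    and X: "X \<in> carrier_mat n q" and Y: "Y \<in> carrier_mat q n" and W: "W \<in> carrier_mat q q"
    and QS: "Q * S = 1\<^sub>m n" and eq: "(1\<^sub>m q - Y * S * X) * W = 1\<^sub>m q"
  shows "(Q - X * Y) * (S + S * X * W * Y * S) = 1\<^sub>m n"
proof -
  note dims = carrier_matD[OF Q] carrier_matD[OF S] carrier_matD[OF X] carrier_matD[OF Y]
    carrier_matD[OF W]
  have QS': "Q * (S * Z) = Z" if "dim_row Z = n" for Z
    using arg_cong[OF QS, of "\<lambda>M. M * Z"] that by (simp add: dims mat_algebra)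
  have W_unfold: "W * Z = Z + Y * (S * (X * (W * Z)))" if "dim_row Z = q" for Z
  proof -
    have "Z = (1\<^sub>m q - Y * S * X) * W * Z" using eq that by (simp add: mat_algebra)
    also have "\<dots> = W * Z + - (Y * (S * (X * (W * Z))))"
      using that by (simp add: dims mat_algebra)
    finally have "Z = W * Z + - (Y * (S * (X * (W * Z))))" .
    then have "Z + Y * (S * (X * (W * Z)))
        = W * Z + - (Y * (S * (X * (W * Z)))) + Y * (S * (X * (W * Z)))"
      by (rule arg_cong)
    also have "\<dots> = W * Z" using that by (simp add: dims mat_algebra)
    finally show ?thesis ..
  qed
  have expand: "(Q - X * Y) * (S + S * X * W * Y * S)
      = 1\<^sub>m n + (X * (W * (Y * S)) + (- (X * (Y * S)) + - (X * (Y * (S * (X * (W * (Y * S))))))))"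
    by (simp add: dims mat_algebra QS QS')
  have "X * (W * (Y * S)) = X * (Y * S) + X * (Y * (S * (X * (W * (Y * S)))))"
    by (subst W_unfold) (simp_all add: dims mat_algebra)
  then show ?thesis
    unfolding expand by (rule add_sum_cancel) (auto simp: dims)
qed

text \<open>
  The same cancellation with the roles exchanged: \<open>T\<close> satisfies the resolvent identity
  \<open>T = S + S X Y T\<close>.
\<close>

lemma woodbury_converse:
  fixes Q S X Y T :: "'a :: comm_ring_1 mat"
  assumes Q: "Q \<in> carrier_mat n n" and S: "S \<in> carrier_mat n n"
    and X: "X \<in> carrier_mat n q" and Y: "Y \<in> carrier_mat q n" and T: "T \<in> carrier_mat n n"
    and SQ: "S * Q = 1\<^sub>m n" and eq: "(Q - X * Y) * T = 1\<^sub>m n"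
  shows "(1\<^sub>m q - Y * S * X) * (1\<^sub>m q + Y * T * X) = 1\<^sub>m q"
proof -
  note dims = carrier_matD[OF Q] carrier_matD[OF S] carrier_matD[OF X] carrier_matD[OF Y]
    carrier_matD[OF T]
  have SQ': "S * (Q * Z) = Z" if "dim_row Z = n" for Z
    using arg_cong[OF SQ, of "\<lambda>M. M * Z"] that by (simp add: dims mat_algebra)
  have T_unfold: "T = S + S * (X * (Y * T))"
  proof -
    have "S = S * ((Q - X * Y) * T)" using eq by (simp add: dims mat_algebra)
    also have "\<dots> = T + - (S * (X * (Y * T)))"
      by (simp add: dims mat_algebra SQ')
    finally have "S + S * (X * (Y * T)) = T + - (S * (X * (Y * T))) + S * (X * (Y * T))"
      by (rule arg_cong)
    also have "\<dots> = T" by (simp add: dims mat_algebra)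
    finally show ?thesis ..
  qed
  have expand: "(1\<^sub>m q - Y * S * X) * (1\<^sub>m q + Y * T * X)
      = 1\<^sub>m q + (Y * (T * X) + (- (Y * (S * X)) + - (Y * (S * (X * (Y * (T * X)))))))"
    by (simp add: dims mat_algebra)
  have "Y * (T * X) = Y * (S * X) + Y * (S * (X * (Y * (T * X))))"
    by (subst T_unfold) (simp add: dims mat_algebra)
  then show ?thesis
    unfolding expand by (rule add_sum_cancel) (auto simp: dims)
qed

text \<open>
  Both Woodbury formulas are polynomial in \<open>S\<close>, \<open>X\<close>, \<open>Y\<close> and the known inverse, so they
  stay inside the ring of stable proper functions.
\<close>

lemma stable_inverse_perturbation_iff:
  assumes Q: "Q \<in> carrier_mat r r" and S: "S \<in> RHinf r r" and QS: "Q * S = 1\<^sub>m r"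
    and X: "X \<in> RHinf r q" and Y: "Y \<in> RHinf q r"
  shows "invertible_mat (Q - X * Y) \<and> mat_inv (Q - X * Y) \<in> RHinf r r
    \<longleftrightarrow> invertible_mat (1\<^sub>m q - Y * S * X) \<and> mat_inv (1\<^sub>m q - Y * S * X) \<in> RHinf q q"
proof -
  note c = RHinf.mats_carrier[OF S] RHinf.mats_carrier[OF X] RHinf.mats_carrier[OF Y]
  have SQ: "S * Q = 1\<^sub>m r" using mat_mult_left_right_inverse[OF Q c(1) QS] .
  have M: "Q - X * Y \<in> carrier_mat r r" "1\<^sub>m q - Y * S * X \<in> carrier_mat q q"
    using Q c by auto
  show ?thesis
  proof (intro iffI; elim conjE)
    assume inv: "invertible_mat (Q - X * Y)" and T: "mat_inv (Q - X * Y) \<in> RHinf r r"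
    have "(1\<^sub>m q - Y * S * X) * (1\<^sub>m q + Y * mat_inv (Q - X * Y) * X) = 1\<^sub>m q"
      using woodbury_converse[OF Q c(1-3) _ SQ] mat_invD[OF inv M(1)] by blast
    moreover have "1\<^sub>m q + Y * mat_inv (Q - X * Y) * X \<in> RHinf q q"
      using X Y T by (intro RHinf.mats_add RHinf.mats_1 RHinf.mats_mult)
    ultimately show "invertible_mat (1\<^sub>m q - Y * S * X)
        \<and> mat_inv (1\<^sub>m q - Y * S * X) \<in> RHinf q q"
      using mat_inv_eqI[OF M(2)] RHinf.mats_carrier by metis
  next
    assume inv: "invertible_mat (1\<^sub>m q - Y * S * X)"
      and W: "mat_inv (1\<^sub>m q - Y * S * X) \<in> RHinf q q"
    have "(Q - X * Y) * (S + S * X * mat_inv (1\<^sub>m q - Y * S * X) * Y * S) = 1\<^sub>m r"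
      using woodbury[OF Q c(1-3) _ QS] mat_invD[OF inv M(2)] by blast
    moreover have "S + S * X * mat_inv (1\<^sub>m q - Y * S * X) * Y * S \<in> RHinf r r"
      using S X Y W by (intro RHinf.mats_add RHinf.mats_mult)
    ultimately show "invertible_mat (Q - X * Y) \<and> mat_inv (Q - X * Y) \<in> RHinf r r"
      using mat_inv_eqI[OF M(1)] RHinf.mats_carrier by metis
  qed
qed

section \<open>The closed loop as a matrix\<close>

text \<open>
  The matrix \<open>I - R\<close> of the closed loop equation \<open>(I - R) \<eta> = d\<close>, with \<open>E\<close> in place of \<open>z I - A\<close>.
\<close>

definition return_difference ::
    "nat \<Rightarrow> nat \<Rightarrow> nat \<Rightarrow> 'a :: comm_ring_1 mat \<Rightarrow> 'a mat \<Rightarrow> 'a mat \<Rightarrow> 'a mat \<Rightarrow> 'a mat \<Rightarrow> 'a mat" where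
  "return_difference n m p E B C D K =
     four_block_mat (four_block_mat E (- B) (0\<^sub>m m n) (1\<^sub>m m))
       (0\<^sub>m n p @\<^sub>r (- K)) ((- C) @\<^sub>c (- D)) (1\<^sub>m p)"

lemma one_minus_closed_loop_map:
  assumes "A \<in> carrier_mat n n" "B \<in> carrier_mat n m" "C \<in> carrier_mat p n" "D \<in> carrier_mat p m"
    "K \<in> carrier_mat m p"
  shows "1\<^sub>m (n + m + p) - closed_loop_map n m p A B C D K
    = return_difference n m p (tf_z \<cdot>\<^sub>m 1\<^sub>m n - A) B C D K"
  unfolding closed_loop_map_def return_difference_def
  using assms
  by (intro eq_matI) (auto simp: index_append_rows index_append_cols algebra_simps)

text \<open>
  The columns are the responses of \<open>(x, u, y)\<close> to disturbances of the state, control and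
  measurement equations. The control column comes from the other two: passing from \<open>u\<close> to
  \<open>u - d_u\<close> moves \<open>d_u\<close> into the state and measurement equations as \<open>B d_u\<close> and \<open>D d_u\<close>, and
  adding \<open>d_u\<close> back gives the summand \<open>1\<^sub>m m\<close>. The last block row is
  \<open>y = C x + D u + d_y\<close>.
\<close>

definition closed_loop_inverse ::
    "nat \<Rightarrow> nat \<Rightarrow> nat \<Rightarrow> 'a :: comm_ring_1 mat \<Rightarrow> 'a mat \<Rightarrow> 'a mat \<Rightarrow> 'a mat \<Rightarrow> 'a mat \<Rightarrow> 'a mat \<Rightarrow> 'a mat \<Rightarrow> 'a mat"
  where
  "closed_loop_inverse n m p B C D Pxx Pxy Pux Puy =
     (let xu = Pxx * B + Pxy * D; uu = Pux * B + Puy * D + 1\<^sub>m m in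
      four_block_mat (four_block_mat Pxx xu Pux uu) (Pxy @\<^sub>r Puy)
        ((C * Pxx + D * Pux) @\<^sub>c (C * xu + D * uu)) (C * Pxy + D * Puy + 1\<^sub>m p))"

text \<open>
  Hypotheses \<open>x\<close> are the state equation for the responses to state and measurement
  disturbances, hypotheses \<open>u\<close> the control law for them. The control column
  is checked by expanding it as \<open>B\<close> and \<open>D\<close> multiples of the other two plus the identity.
\<close>

lemma return_difference_mult_closed_loop_inverse:
  fixes E :: "'a :: comm_ring_1 mat"
  assumes E: "E \<in> carrier_mat n n" and B: "B \<in> carrier_mat n m"
    and C: "C \<in> carrier_mat p n" and D: "D \<in> carrier_mat p m" and K: "K \<in> carrier_mat m p"
    and P: "Pxx \<in> carrier_mat n n" "Pxy \<in> carrier_mat n p"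
      "Pux \<in> carrier_mat m n" "Puy \<in> carrier_mat m p"
    and x: "E * Pxx - B * Pux = 1\<^sub>m n" "E * Pxy - B * Puy = 0\<^sub>m n p"
    and u: "Pux = K * (C * Pxx + D * Pux)" "Puy = K * (C * Pxy + D * Puy + 1\<^sub>m p)"
  shows "return_difference n m p E B C D K * closed_loop_inverse n m p B C D Pxx Pxy Pux Puy
    = 1\<^sub>m (n + m + p)"
proof -
  note dims = carrier_matD[OF E] carrier_matD[OF B] carrier_matD[OF C] carrier_matD[OF D]
    carrier_matD[OF K] P[THEN carrier_matD(1)] P[THEN carrier_matD(2)]
  define xu where "xu = Pxx * B + Pxy * D"
  define uu where "uu = Pux * B + Puy * D + 1\<^sub>m m"
  define yx where "yx = C * Pxx + D * Pux"
  define yu where "yu = C * xu + D * uu"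
  define yy where "yy = C * Pxy + D * Puy + 1\<^sub>m p"
  have c: "xu \<in> carrier_mat n m" "uu \<in> carrier_mat m m" "yx \<in> carrier_mat p n"
    "yu \<in> carrier_mat p m" "yy \<in> carrier_mat p p"
    by (auto simp: xu_def uu_def yx_def yu_def yy_def dims)
  note dims' = c[THEN carrier_matD(1)] c[THEN carrier_matD(2)]
  have xu_row: "E * xu - B * uu = 0\<^sub>m n m"
  proof -
    have "E * xu - B * uu = (E * Pxx - B * Pux) * B + (E * Pxy - B * Puy) * D - B"
      unfolding xu_def uu_def by (simp add: dims mat_algebra)
    then show ?thesis unfolding x by (simp add: dims mat_algebra)
  qed
  have yu: "yu = yx * B + yy * D"
    unfolding yu_def yx_def yy_def xu_def uu_def by (simp add: dims mat_algebra)
  have u': "K * yx = Pux" "K * yy = Puy"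
    using u unfolding yx_def yy_def by simp_all
  have u'': "K * yu = Pux * B + Puy * D"
    unfolding yu using u' by (simp add: dims dims' mat_algebra flip: u')
  have inner: "four_block_mat E (- B) (0\<^sub>m m n) (1\<^sub>m m) * four_block_mat Pxx xu Pux uu
      = four_block_mat (1\<^sub>m n) (0\<^sub>m n m) Pux uu"
  proof -
    have "E * Pxx + - B * Pux = 1\<^sub>m n" "E * xu + - B * uu = 0\<^sub>m n m"
      using x(1) xu_row by (simp_all add: dims dims' mat_algebra)
    then show ?thesis
      using E B P c by (subst mult_four_block_mat[of _ n n _ m _ m _ _ n _ m])
        (auto simp: mat_algebra)
  qed
  have feedback: "(0\<^sub>m n p @\<^sub>r (- K)) * (yx @\<^sub>c yu)
      = four_block_mat (0\<^sub>m n n) (0\<^sub>m n m) (- Pux) (- (Pux * B + Puy * D))"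
    using K c by (subst append_rows_mult_append_cols[of _ n p _ m _ n _ m])
      (auto simp: uminus_dim unit_dim u' u'')
  have "four_block_mat E (- B) (0\<^sub>m m n) (1\<^sub>m m) * (Pxy @\<^sub>r Puy) = 0\<^sub>m n p @\<^sub>r Puy"
  proof -
    have "E * Pxy + - B * Puy = 0\<^sub>m n p" using x(2) by (simp add: dims mat_algebra)
    then show ?thesis
      using E B P by (subst four_block_mult_append_rows[of _ n n _ m _ m _ _ p])
        (auto simp: mat_algebra)
  qed
  moreover have "(0\<^sub>m n p @\<^sub>r (- K)) * yy = 0\<^sub>m n p @\<^sub>r (- Puy)"
  proof -
    have "(0\<^sub>m n p @\<^sub>r (- K)) * yy = (0\<^sub>m n p @\<^sub>r (- K)) * (yy @\<^sub>c 0\<^sub>m p 0)"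
      using c by (intro arg_cong[where f = "(*) _"]) (auto intro!: eq_matI simp: index_append_cols)
    also have "\<dots> = four_block_mat (0\<^sub>m n p) (0\<^sub>m n 0) (- Puy) (0\<^sub>m m 0)"
      using K c by (subst append_rows_mult_append_cols[of _ n p _ m _ p _ 0])
        (auto simp: uminus_dim unit_dim u')
    finally show ?thesis using P by (simp add: append_rows_def)
  qed
  moreover have "(0\<^sub>m n p @\<^sub>r Puy) + (0\<^sub>m n p @\<^sub>r (- Puy)) = 0\<^sub>m (n + m) p"
    using P by (intro eq_matI) (auto simp: index_append_rows)
  moreover have "((- C) @\<^sub>c (- D)) * four_block_mat Pxx xu Pux uu + 1\<^sub>m p * (yx @\<^sub>c yu)
      = 0\<^sub>m p (n + m)"
  proof -
    have "((- C) @\<^sub>c (- D)) * four_block_mat Pxx xu Pux uu = (- yx) @\<^sub>c (- yu)"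
      using C D P c by (subst append_cols_mult_four_block[of _ p n _ m _ n _ m])
        (auto simp: yx_def yu_def mat_algebra dims)
    moreover have "((- yx) @\<^sub>c (- yu)) + (yx @\<^sub>c yu) = 0\<^sub>m p (n + m)"
      using c by (intro eq_matI) (auto simp: index_append_cols)
    ultimately show ?thesis using c by (simp add: mat_algebra)
  qed
  moreover have "((- C) @\<^sub>c (- D)) * (Pxy @\<^sub>r Puy) + 1\<^sub>m p * yy = 1\<^sub>m p"
    using C D P c by (subst append_cols_mult_append_rows[of _ p n _ m _ p])
      (auto simp: yy_def mat_algebra dims)
  moreover have "four_block_mat (1\<^sub>m n) (0\<^sub>m n m) Pux uu
      + four_block_mat (0\<^sub>m n n) (0\<^sub>m n m) (- Pux) (- (Pux * B + Puy * D)) = 1\<^sub>m (n + m)"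
    using B D P c by (intro eq_matI) (auto simp: uu_def)
  ultimately show ?thesis
    unfolding return_difference_def closed_loop_inverse_def Let_def
    unfolding xu_def[symmetric] uu_def[symmetric] yx_def[symmetric] yu_def[symmetric]
      yy_def[symmetric]
    using E B C D K P c
    by (subst mult_four_block_mat[of _ "n + m" "n + m" _ p _ p _ _ "n + m" _ p])
      (auto simp: inner feedback)
qed

definition state_output_inj :: "nat \<Rightarrow> nat \<Rightarrow> nat \<Rightarrow> 'a :: comm_ring_1 mat" where
  "state_output_inj n m p = four_block_mat (1\<^sub>m n @\<^sub>r 0\<^sub>m m n) (0\<^sub>m (n + m) p) (0\<^sub>m p n) (1\<^sub>m p)"

definition state_input_proj :: "nat \<Rightarrow> nat \<Rightarrow> nat \<Rightarrow> 'a :: comm_ring_1 mat" where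
  "state_input_proj n m p = 1\<^sub>m (n + m) @\<^sub>c 0\<^sub>m (n + m) p"

text \<open>
  A perturbation of the plant changes only the state and measurement rows of the closed
  loop, and there only the state and control columns.
\<close>

lemma return_difference_perturb:
  fixes E :: "'a :: comm_ring_1 mat"
  assumes E: "E \<in> carrier_mat n n" and B: "B \<in> carrier_mat n m"
    and C: "C \<in> carrier_mat p n" and D: "D \<in> carrier_mat p m" and K: "K \<in> carrier_mat m p"
    and d: "dA \<in> carrier_mat n n" "dB \<in> carrier_mat n m"
      "dC \<in> carrier_mat p n" "dD \<in> carrier_mat p m"
  shows "return_difference n m p (E - dA) (B + dB) (C + dC) (D + dD) K
    = return_difference n m p E B C D K
      - state_output_inj n m p * (four_block_mat dA dB dC dD * state_input_proj n m p)"
proof -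
  have "four_block_mat dA dB dC dD * state_input_proj n m p
      = four_block_mat (dA @\<^sub>c dB) (0\<^sub>m n p) (dC @\<^sub>c dD) (0\<^sub>m p p)"
  proof -
    have "four_block_mat dA dB dC dD * state_input_proj n m p
        = (four_block_mat dA dB dC dD @\<^sub>r 0\<^sub>m 0 (n + m)) * (1\<^sub>m (n + m) @\<^sub>c 0\<^sub>m (n + m) p)"
      unfolding state_input_proj_def using d
      by (intro arg_cong[where f = "\<lambda>M. M * _"]) (auto intro!: eq_matI simp: index_append_rows)
    also have "\<dots> = four_block_mat (four_block_mat dA dB dC dD) (0\<^sub>m (n + p) p)
        (0\<^sub>m 0 (n + m)) (0\<^sub>m 0 p)"
      using d by (subst append_rows_mult_append_cols[of _ "n + p" "n + m" _ 0 _ "n + m" _ p])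
        (auto simp: unit_dim)
    also have "\<dots> = four_block_mat (dA @\<^sub>c dB) (0\<^sub>m n p) (dC @\<^sub>c dD) (0\<^sub>m p p)"
      using d by (intro eq_matI) (auto simp: index_append_cols)
    finally show ?thesis .
  qed
  moreover have "state_output_inj n m p *
        four_block_mat (dA @\<^sub>c dB) (0\<^sub>m n p) (dC @\<^sub>c dD) (0\<^sub>m p p)
      = four_block_mat (four_block_mat dA dB (0\<^sub>m m n) (0\<^sub>m m m)) (0\<^sub>m (n + m) p)
          (dC @\<^sub>c dD) (0\<^sub>m p p)"
  proof -
    have "(1\<^sub>m n @\<^sub>r 0\<^sub>m m n) * (dA @\<^sub>c dB) = four_block_mat dA dB (0\<^sub>m m n) (0\<^sub>m m m)"
      using d by (subst append_rows_mult_append_cols[of _ n n _ m _ n _ m]) (auto simp: unit_dim)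
    then show ?thesis
      unfolding state_output_inj_def using d
      by (subst mult_four_block_mat[of _ "n + m" n _ p _ p _ _ "n + m" _ p])
        (auto simp: unit_dim add_dim)
  qed
  ultimately show ?thesis
    unfolding return_difference_def using E B C D K d
    by (intro eq_matI) (auto simp: index_append_rows index_append_cols)
qed

text \<open>
  The responses of state and control to state and measurement disturbances are the
  prescribed ones, and the compression selects exactly these.
\<close>

lemma closed_loop_inverse_compression:
  fixes Pxx :: "'a :: comm_ring_1 mat"
  assumes "B \<in> carrier_mat n m" "C \<in> carrier_mat p n" "D \<in> carrier_mat p m"
    "Pxx \<in> carrier_mat n n" "Pxy \<in> carrier_mat n p"
    "Pux \<in> carrier_mat m n" "Puy \<in> carrier_mat m p"
  shows "state_input_proj n m p * closed_loop_inverse n m p B C D Pxx Pxy Pux Puy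
      * state_output_inj n m p = four_block_mat Pxx Pxy Pux Puy"
proof -
  define S11 where "S11 = four_block_mat Pxx (Pxx * B + Pxy * D) Pux (Pux * B + Puy * D + 1\<^sub>m m)"
  have S11: "S11 \<in> carrier_mat (n + m) (n + m)"
    unfolding S11_def using assms by auto
  have "state_input_proj n m p * closed_loop_inverse n m p B C D Pxx Pxy Pux Puy
      = S11 @\<^sub>c (Pxy @\<^sub>r Puy)"
    unfolding state_input_proj_def closed_loop_inverse_def Let_def S11_def[symmetric]
    using assms S11
    by (subst append_cols_mult_four_block[of _ "n + m" "n + m" _ p _ "n + m" _ p])
      (auto simp: unit_dim add_dim)
  also have "\<dots> * state_output_inj n m p = (S11 * (1\<^sub>m n @\<^sub>r 0\<^sub>m m n)) @\<^sub>c (Pxy @\<^sub>r Puy)"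
    unfolding state_output_inj_def
    using assms S11
    by (subst append_cols_mult_four_block[of _ "n + m" "n + m" _ p _ n _ p])
      (auto simp: unit_dim add_dim)
  also have "S11 * (1\<^sub>m n @\<^sub>r 0\<^sub>m m n) = Pxx @\<^sub>r Pux"
    unfolding S11_def using assms
    by (subst four_block_mult_append_rows[of _ n n _ m _ m _ _ n]) (auto simp: unit_dim add_dim)
  also have "(Pxx @\<^sub>r Pux) @\<^sub>c (Pxy @\<^sub>r Puy) = four_block_mat Pxx Pxy Pux Puy"
    using assms by (intro eq_matI) (auto simp: index_append_rows index_append_cols)
  finally show ?thesis .
qed

text \<open>
  The second affine constraint \<open>y\<close> gives \<open>K0 C = Pux V\<close>: the term \<open>Puy C = Pux E\<close> cancels
  against \<open>Pux V Pxx E\<close>. With \<open>V\<close> the inverse of \<open>Pxx\<close> this yields \<open>K0 (C Pxx) = Pux\<close> and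
  \<open>K0 (C Pxy + I) = Puy\<close>, the control law for a plant without feedthrough. The
  factor \<open>W\<close> compensates the feedthrough: \<open>W (Z + D K0 Z) = Z\<close>.
\<close>

lemma controller_realizes_responses:
  fixes E :: "'a :: comm_ring_1 mat"
  assumes E: "E \<in> carrier_mat n n"
    and C: "C \<in> carrier_mat p n" and D: "D \<in> carrier_mat p m"
    and P: "Pxx \<in> carrier_mat n n" "Pxy \<in> carrier_mat n p"
      "Pux \<in> carrier_mat m n" "Puy \<in> carrier_mat m p"
    and V: "V \<in> carrier_mat n n" "V * Pxx = 1\<^sub>m n"
    and y: "Pxx * E - Pxy * C = 1\<^sub>m n" "Pux * E - Puy * C = 0\<^sub>m m n"
    and K0: "K0 = Puy - Pux * V * Pxy"
    and W: "W \<in> carrier_mat p p" "W * (1\<^sub>m p + D * K0) = 1\<^sub>m p"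
  shows "K0 * W * (C * Pxx + D * Pux) = Pux"
    and "K0 * W * (C * Pxy + D * Puy + 1\<^sub>m p) = Puy"
proof -
  note dims = carrier_matD[OF E] carrier_matD[OF C] carrier_matD[OF D]
    P[THEN carrier_matD(1)] P[THEN carrier_matD(2)] carrier_matD[OF V(1)] carrier_matD[OF W(1)]
  have K0c: "K0 \<in> carrier_mat m p" unfolding K0 by (auto simp: dims)
  note dims = dims carrier_matD[OF K0c]
  have V': "V * (Pxx * Z) = Z" if "dim_row Z = n" for Z
    using arg_cong[OF V(2), of "\<lambda>M. M * Z"] that by (simp add: dims mat_algebra)
  have W': "W * (Z + D * (K0 * Z)) = Z" if "dim_row Z = p" for Z
    using arg_cong[OF W(2), of "\<lambda>M. M * Z"] that by (simp add: dims mat_algebra)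
  have PxyC: "Pxy * C = Pxx * E - 1\<^sub>m n"
  proof -
    have "Pxx * E - (Pxx * E - Pxy * C) = Pxy * C" by (intro eq_matI) (auto simp: dims)
    then show ?thesis unfolding y(1) by simp
  qed
  have PuyC: "Puy * C = Pux * E"
  proof -
    have "Pux * E - (Pux * E - Puy * C) = Puy * C" by (intro eq_matI) (auto simp: dims)
    then show ?thesis unfolding y(2) by (simp add: dims mat_algebra)
  qed
  have K0C: "K0 * C = Pux * V"
  proof -
    have "K0 * C = Puy * C - Pux * (V * (Pxy * C))"
      unfolding K0 by (simp add: dims mat_algebra)
    also have "\<dots> = Pux * V"
      unfolding PxyC PuyC by (simp add: dims mat_algebra V')
    finally show ?thesis .
  qed
  have xx: "K0 * (C * Pxx) = Pux"
    using arg_cong[OF K0C, of "\<lambda>M. M * Pxx"] V by (simp add: dims mat_algebra)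
  have "K0 * (C * Pxy) = Pux * (V * Pxy)"
    using arg_cong[OF K0C, of "\<lambda>M. M * Pxy"] by (simp add: dims mat_algebra)
  then have xy: "K0 * (C * Pxy) + K0 = Puy"
    unfolding K0 by (simp add: dims mat_algebra)
  show "K0 * W * (C * Pxx + D * Pux) = Pux"
  proof -
    have "K0 * W * (C * Pxx + D * Pux) = K0 * (W * (C * Pxx + D * (K0 * (C * Pxx))))"
      by (simp only: xx) (simp add: dims mult_assoc_dim)
    also have "\<dots> = K0 * (C * Pxx)" by (subst W') (simp_all add: dims)
    finally show ?thesis using xx by simp
  qed
  show "K0 * W * (C * Pxy + D * Puy + 1\<^sub>m p) = Puy"
  proof -
    have "K0 * (C * Pxy + 1\<^sub>m p) = Puy" using xy by (simp add: dims distrib_dim unit_dim)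
    then have "K0 * W * (C * Pxy + D * Puy + 1\<^sub>m p)
        = K0 * (W * ((C * Pxy + 1\<^sub>m p) + D * (K0 * (C * Pxy + 1\<^sub>m p))))"
      by (simp add: dims mult_assoc_dim) (simp add: dims add_dim)
    also have "\<dots> = K0 * (C * Pxy + 1\<^sub>m p)" by (subst W') (simp_all add: dims)
    finally show ?thesis using \<open>K0 * (C * Pxy + 1\<^sub>m p) = Puy\<close> by simp
  qed
qed

lemma closed_loop_inverse_RHinf:
  assumes "B \<in> RHinf n m" "C \<in> RHinf p n" "D \<in> RHinf p m"
    "Pxx \<in> RHinf n n" "Pxy \<in> RHinf n p" "Pux \<in> RHinf m n" "Puy \<in> RHinf m p"
  shows "closed_loop_inverse n m p B C D Pxx Pxy Pux Puy \<in> RHinf (n + m + p) (n + m + p)"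
proof -
  have "Pxx * B + Pxy * D \<in> RHinf n m" "Pux * B + Puy * D + 1\<^sub>m m \<in> RHinf m m"
    "C * Pxx + D * Pux \<in> RHinf p n" "C * Pxy + D * Puy + 1\<^sub>m p \<in> RHinf p p"
    using assms by (blast intro: RHinf.mats_add RHinf.mats_mult RHinf.mats_1)+
  moreover from this assms
  have "C * (Pxx * B + Pxy * D) + D * (Pux * B + Puy * D + 1\<^sub>m m) \<in> RHinf p m"
    by (blast intro: RHinf.mats_add RHinf.mats_mult)
  ultimately show ?thesis
    unfolding closed_loop_inverse_def Let_def using assms
    by (intro RHinf.mats_four_block RHinf.mats_append_rows RHinf.mats_append_cols)
qed

section \<open>Robust stability of the nominal controller\<close>

text \<open>
  By the state equation \<open>z Pxx = I + A Pxx + B Pux\<close>, and the last two terms are strictly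
  proper. Inverting \<open>z Pxx\<close> instead of \<open>Pxx\<close> is where the factor \<open>inverse tf_z\<close> comes from.
\<close>

lemma invertible_state_response:
  assumes A: "A \<in> carrier_mat n n" and B: "B \<in> carrier_mat n m"
    and P: "Pxx \<in> carrier_mat n n" "tf_z \<cdot>\<^sub>m Pxx \<in> proper_mats n n"
      "Pux \<in> carrier_mat m n" "tf_z \<cdot>\<^sub>m Pux \<in> proper_mats m n"
    and A': "A \<in> proper_mats n n" and B': "B \<in> proper_mats n m"
    and x: "(tf_z \<cdot>\<^sub>m 1\<^sub>m n - A) * Pxx - B * Pux = 1\<^sub>m n"
  shows "invertible_mat Pxx" "inverse tf_z \<cdot>\<^sub>m mat_inv Pxx \<in> proper_mats n n"
proof -
  define N where "N = A * Pxx + B * Pux"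
  have Nc: "N \<in> carrier_mat n n" using A B P by (auto simp: N_def)
  have "tf_z \<cdot>\<^sub>m N = A * (tf_z \<cdot>\<^sub>m Pxx) + B * (tf_z \<cdot>\<^sub>m Pux)"
    unfolding N_def using A B P
    by (simp add: add_smult_distrib_left_mat[of _ n n] mult_smult_distrib)
  also have "\<dots> \<in> proper_mats n n"
    by (intro proper.mats_add proper.mats_mult[OF A' P(2)] proper.mats_mult[OF B' P(4)])
  finally obtain W where W: "W \<in> proper_mats n n" "(1\<^sub>m n + N) * W = 1\<^sub>m n"
    by (rule proper_inverse_of_strictly_proper_perturbation)
  have Wc: "W \<in> carrier_mat n n" using W(1) by (rule proper.mats_carrier)
  have "(tf_z \<cdot>\<^sub>m 1\<^sub>m n) * Pxx = tf_z \<cdot>\<^sub>m Pxx"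
    using P by (simp add: mult_smult_assoc_mat[of _ n n])
  moreover have "(tf_z \<cdot>\<^sub>m 1\<^sub>m n) * Pxx = ((tf_z \<cdot>\<^sub>m 1\<^sub>m n - A) * Pxx - B * Pux) + N"
    unfolding N_def using A B P by (simp add: mat_algebra)
  ultimately have "tf_z \<cdot>\<^sub>m Pxx = 1\<^sub>m n + N" unfolding x by simp
  then have "(tf_z \<cdot>\<^sub>m Pxx) * W = 1\<^sub>m n" using W(2) by simp
  then have "Pxx * (tf_z \<cdot>\<^sub>m W) = 1\<^sub>m n"
    using P Wc by (simp add: mult_smult_distrib mult_smult_assoc_mat)
  then have inv: "invertible_mat Pxx" "mat_inv Pxx = tf_z \<cdot>\<^sub>m W"
    using mat_inv_eqI[OF P(1) smult_carrier_mat[OF Wc]] by blast+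
  show "invertible_mat Pxx" by fact
  have "inverse tf_z \<cdot>\<^sub>m mat_inv Pxx = W"
    unfolding inv(2) using tf_z_nonzero by (intro eq_matI) auto
  then show "inverse tf_z \<cdot>\<^sub>m mat_inv Pxx \<in> proper_mats n n" using W(1) by simp
qed

theorem corollary17:
  fixes n m p :: nat
    and A B C D :: "real mat"
    and Phi_xx Phi_ux Phi_xy Phi_uy Delta_A Delta_B Delta_C Delta_D Phi Delta K0 K :: "tf mat"
  assumes "A \<in> carrier_mat n n" and "B \<in> carrier_mat n m"
    and "C \<in> carrier_mat p n" and "D \<in> carrier_mat p m"
    and "Phi = four_block_mat Phi_xx Phi_xy Phi_ux Phi_uy"
    and "((tf_z \<cdot>\<^sub>m 1\<^sub>m n - const_tf_mat A) @\<^sub>c (- const_tf_mat B)) * Phi = 1\<^sub>m n @\<^sub>c 0\<^sub>m n p"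
    and "Phi * ((tf_z \<cdot>\<^sub>m 1\<^sub>m n - const_tf_mat A) @\<^sub>r (- const_tf_mat C)) = 1\<^sub>m n @\<^sub>r 0\<^sub>m m n"
    and "Phi_xx \<in> zinv_RHinf n n" and "Phi_xy \<in> zinv_RHinf n p"
    and "Phi_ux \<in> zinv_RHinf m n" and "Phi_uy \<in> RHinf m p"
    and "Delta_A \<in> RHinf n n" and "Delta_B \<in> RHinf n m"
    and "Delta_C \<in> RHinf p n" and "Delta_D \<in> RHinf p m"
    and "Delta = four_block_mat Delta_A Delta_B Delta_C Delta_D"
    and "K0 = Phi_uy - Phi_ux * mat_inv Phi_xx * Phi_xy"
    and "invertible_mat (1\<^sub>m p + const_tf_mat D * K0)"
    and "mat_inv (1\<^sub>m p + const_tf_mat D * K0) \<in> proper_mats p p"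
    and "K = K0 * mat_inv (1\<^sub>m p + const_tf_mat D * K0)"
  shows "internally_stabilizes n m p
           (const_tf_mat A + Delta_A) (const_tf_mat B + Delta_B)
           (const_tf_mat C + Delta_C) (const_tf_mat D + Delta_D) K
         \<longleftrightarrow> invertible_mat (1\<^sub>m (n + p) - Delta * Phi) \<and>
             mat_inv (1\<^sub>m (n + p) - Delta * Phi) \<in> RHinf (n + p) (n + p)"
proof -
  define At where "At = const_tf_mat A"
  define Bt where "Bt = const_tf_mat B"
  define Ct where "Ct = const_tf_mat C"
  define Dt where "Dt = const_tf_mat D"
  note const_defs = At_def Bt_def Ct_def Dt_def
  define E where "E = tf_z \<cdot>\<^sub>m 1\<^sub>m n - At"
  note Phi_RH = zinv_RHinfD[OF assms(8)] zinv_RHinfD[OF assms(9)] zinv_RHinfD[OF assms(10)]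
  note const_RH = const_tf_mat_RHinf[OF assms(1), folded const_defs]
    const_tf_mat_RHinf[OF assms(2), folded const_defs] const_tf_mat_RHinf[OF assms(3), folded const_defs]
    const_tf_mat_RHinf[OF assms(4), folded const_defs]
  note c = const_RH[THEN RHinf.mats_carrier]
  note P = RHinf.mats_carrier[OF Phi_RH(2)] RHinf.mats_carrier[OF Phi_RH(4)]
    RHinf.mats_carrier[OF Phi_RH(6)] RHinf.mats_carrier[OF assms(11)]
  note d = assms(12-15)[THEN RHinf.mats_carrier]
  have E: "E \<in> carrier_mat n n" unfolding E_def by (rule minus_carrier_mat[OF c(1)])
  note dims = c[THEN carrier_matD(1)] c[THEN carrier_matD(2)]
    P[THEN carrier_matD(1)] P[THEN carrier_matD(2)] carrier_matD[OF E]

  have "(E * Phi_xx + - Bt * Phi_ux) @\<^sub>c (E * Phi_xy + - Bt * Phi_uy) = 1\<^sub>m n @\<^sub>c 0\<^sub>m n p"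
    using assms(6) append_cols_mult_four_block[of E n n "- Bt" m Phi_xx n Phi_xy p Phi_ux Phi_uy]
      E c P by (simp add: assms(5) const_defs[symmetric] E_def[symmetric])
  note x = append_cols_eqD[OF this, of n n p]
  have x: "E * Phi_xx - Bt * Phi_ux = 1\<^sub>m n" "E * Phi_xy - Bt * Phi_uy = 0\<^sub>m n p"
    using x E c P by (simp_all add: mat_algebra)
  have "(Phi_xx * E + Phi_xy * - Ct) @\<^sub>r (Phi_ux * E + Phi_uy * - Ct) = 1\<^sub>m n @\<^sub>r 0\<^sub>m m n"
    using assms(7) four_block_mult_append_rows[of Phi_xx n n Phi_xy p Phi_ux m Phi_uy E n "- Ct"]
      E c P by (simp add: assms(5) const_defs[symmetric] E_def[symmetric])
  note y = append_rows_eqD[OF this, of n n m]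
  have y: "Phi_xx * E - Phi_xy * Ct = 1\<^sub>m n" "Phi_ux * E - Phi_uy * Ct = 0\<^sub>m m n"
    using y E c P by (simp_all add: mat_algebra)

  have inv_xx: "invertible_mat Phi_xx" "inverse tf_z \<cdot>\<^sub>m mat_inv Phi_xx \<in> proper_mats n n"
    using invertible_state_response[OF c(1,2) P(1) _ P(3) _ _ _ x(1)[unfolded E_def]]
      Phi_RH const_RH RHinf_subset_proper_mats by blast+
  note V = mat_invD[OF inv_xx(1) P(1)]
  define W where "W = mat_inv (1\<^sub>m p + Dt * K0)"
  have K0c: "K0 \<in> carrier_mat m p" unfolding assms(17) using P V by auto
  have "1\<^sub>m p + Dt * K0 \<in> carrier_mat p p" using K0c c by auto
  note W = mat_invD[OF assms(18)[folded const_defs] this, folded W_def]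
  have K: "K = K0 * W" unfolding assms(20) W_def const_defs ..
  have Kc: "K \<in> carrier_mat m p" unfolding K using K0c W by auto
  note u = controller_realizes_responses[OF E c(3,4) P V(1,3) y assms(17) W(1,3), folded K]

  \<comment> \<open>The improper \<open>mat_inv Phi_xx\<close> passes a factor \<open>z\<close> to the strictly proper \<open>Phi_ux\<close>.\<close>
  have "Phi_ux * mat_inv Phi_xx * Phi_xy
      = (tf_z \<cdot>\<^sub>m Phi_ux) * (inverse tf_z \<cdot>\<^sub>m mat_inv Phi_xx) * Phi_xy"
    using P V tf_z_nonzero
    by (simp add: mult_smult_distrib[of _ m n] mult_smult_assoc_mat[of _ m n])
      (auto intro!: eq_matI)
  also have "\<dots> \<in> proper_mats m p"
    using Phi_RH inv_xx(2) RHinf_subset_proper_mats by (blast intro: proper.mats_mult)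
  finally have "K0 \<in> proper_mats m p"
    unfolding assms(17) using assms(11) RHinf_subset_proper_mats by (blast intro: proper.mats_minus)
  then have K_proper: "K \<in> proper_mats m p"
    unfolding assms(20) using assms(19) by (rule proper.mats_mult)

  define Q where "Q = return_difference n m p E Bt Ct Dt K"
  define S where "S = closed_loop_inverse n m p Bt Ct Dt Phi_xx Phi_xy Phi_ux Phi_uy"
  define X :: "tf mat" where "X = state_output_inj n m p"
  define L :: "tf mat" where "L = state_input_proj n m p"
  have Qc: "Q \<in> carrier_mat (n + m + p) (n + m + p)"
    unfolding Q_def return_difference_def using E c Kc by auto
  have S: "S \<in> RHinf (n + m + p) (n + m + p)"
    unfolding S_def using const_RH Phi_RH assms(11) by (intro closed_loop_inverse_RHinf)
  have QS: "Q * S = 1\<^sub>m (n + m + p)"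
    unfolding Q_def S_def
    using return_difference_mult_closed_loop_inverse[OF E c(2-4) Kc P x u[symmetric]] .
  have X: "X \<in> RHinf (n + m + p) (n + p)"
    unfolding X_def state_output_inj_def
    by (intro RHinf.mats_four_block RHinf.mats_append_rows RHinf.mats_0 RHinf.mats_1)
  have L: "L \<in> RHinf (n + m) (n + m + p)"
    unfolding L_def state_input_proj_def
    by (intro RHinf.mats_append_cols RHinf.mats_0 RHinf.mats_1)
  have Delta: "Delta \<in> RHinf (n + p) (n + m)"
    unfolding assms(16) by (intro RHinf.mats_four_block assms)
  have DL: "Delta * L \<in> RHinf (n + p) (n + m + p)"
    using Delta L by (rule RHinf.mats_mult)
  have LSX: "L * S * X = Phi"
    unfolding L_def S_def X_def assms(5) by (rule closed_loop_inverse_compression[OF c(2-4) P])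
  have "Delta * L * S * X = Delta * Phi"
    unfolding LSX[symmetric]
    using carrier_matD[OF RHinf.mats_carrier[OF Delta]] carrier_matD[OF RHinf.mats_carrier[OF L]]
      carrier_matD[OF RHinf.mats_carrier[OF S]] carrier_matD[OF RHinf.mats_carrier[OF X]]
    by (simp add: mult_assoc_dim)
  moreover have "1\<^sub>m (n + m + p) - closed_loop_map n m p (At + Delta_A) (Bt + Delta_B)
      (Ct + Delta_C) (Dt + Delta_D) K = Q - X * (Delta * L)"
  proof -
    have "tf_z \<cdot>\<^sub>m 1\<^sub>m n - (At + Delta_A) = E - Delta_A"
      unfolding E_def using c d by (intro eq_matI) auto
    then show ?thesis
      using c d Kc E unfolding Q_def X_def L_def assms(16)
      by (subst one_minus_closed_loop_map) (simp_all add: return_difference_perturb)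
  qed
  ultimately show ?thesis
    unfolding internally_stabilizes_def const_defs[symmetric]
    using stable_inverse_perturbation_iff[OF Qc S QS X DL] K_proper by simp
qed

end
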